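(* Let $N\geq 1$ be an integer and $\boldsymbol{h}=(h_1,\ldots,h_N)\in\mathbb{C}^N$. Let $L_{\boldsymbol{h}}$ be the operator $-\mathrm{d}^2/\mathrm{d}x^2$ acting componentwise in $\mathscr{H}=L^2\big((0,1),\mathbb{C}^N\big)$ with domain consisting of all $\boldsymbol{u}=(u_1,\ldots,u_N)\in W_2^2\big((0,1),\mathbb{C}^N\big)$ satisfying $u_1(1)=u_2(1)=\cdots=u_N(1)$, $\ u_1'(1)+\cdots+u_N'(1)=0$, and $u_j'(0)=h_j u_j(0)$ for $1\leq j\leq N$. Then the spectrum of $L_{\boldsymbol{h}}$ possesses reflection symmetry with respect to the real line (i.e. $\lambda$ is in the spectrum if and only if $\overline{\lambda}$ is) if and only if $L_{\boldsymbol{h}}$ is $\mathcal{PT}$-symmetric for some automorphism $\mathcal{P}$ of the underlying metric star-graph, i.e. there exists a permutation $\sigma$ of $\{1,\ldots,N\}$ such that, with $(\mathcal{P}\boldsymbol{u})_k=u_{\sigma(k)}$ and $\mathcal{T}\boldsymbol{u}=\overline{\boldsymbol{u}}$, one has $\mathcal{PT}(\mathrm{dom}(L_{\boldsymbol{h}}))\subseteq \mathrm{dom}(L_{\boldsymbol{h}})$ and $\mathcal{PT}L_{\boldsymbol{h}}\boldsymbol{u}=L_{\boldsymbol{h}}\mathcal{PT}\boldsymbol{u}$ for all $\boldsymbol{u}\in\mathrm{dom}(L_{\boldsymbol{h}})$.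
   Context: The operator $L_{\boldsymbol{h}}$ is the Laplacian on the equilateral star graph with $N$ edges of unit length, each edge identified with $[0,1]$ so that the point $1$ corresponds to the common central vertex and $0$ to the degree-one vertices; the conditions at $1$ are the standard (Kirchhoff) vertex conditions and those at $0$ are (possibly complex) Robin conditions. $\mathscr{H}$ carries the inner product $\langle \boldsymbol{u},\boldsymbol{v}\rangle=\sum_{i=1}^N\int_0^1\overline{u_i(x)}v_i(x)\,\mathrm{d}x$. The automorphisms of the metric star graph considered are the permutations of its edges, which act on $\mathscr{H}$ by permuting components. $\mathcal{T}$ is the anti-linear time-reversal operator of complex conjugation. The spectrum of $L_{\boldsymbol{h}}$ consists of eigenvalues. *)

theory Defs
  imports "HOL-Analysis.Analysis"
begin

text \<open>Functions on the edge [0,1]; edges are indexed by a finite type 'n (N = CARD('n)).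
  A vector function u : 'n => real => complex represents an element of L^2((0,1),C^N)
  via its restriction to [0,1].\<close>

definition sq_int :: "(real \<Rightarrow> complex) \<Rightarrow> bool" where
  "sq_int w \<longleftrightarrow> w integrable_on {0..1} \<and> (\<lambda>x. (norm (w x))^2) integrable_on {0..1}"

definition D01 :: "(real \<Rightarrow> complex) \<Rightarrow> real \<Rightarrow> complex" where
  "D01 u x = vector_derivative u (at x within {0..1})"

text \<open>Sobolev space W_2^2(0,1) (continuous representatives): u is differentiable on [0,1]
  with derivative v, and v is absolutely continuous with v(x) - v(0) = integral of w over [0,x],
  where w is square integrable.\<close>
definition W22 :: "(real \<Rightarrow> complex) \<Rightarrow> bool" where
  "W22 u \<longleftrightarrow> (\<exists>v w. (\<forall>x\<in>{0..1}. (u has_vector_derivative v x) (at x within {0..1}))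
       \<and> sq_int w \<and> (\<forall>x\<in>{0..1}. (w has_integral (v x - v 0)) {0..x}))"

definition dom_L :: "('n::finite \<Rightarrow> complex) \<Rightarrow> ('n \<Rightarrow> real \<Rightarrow> complex) \<Rightarrow> bool" where
  "dom_L h u \<longleftrightarrow> (\<forall>j. W22 (u j))
     \<and> (\<forall>i j. u i 1 = u j 1)
     \<and> (\<Sum>j\<in>UNIV. D01 (u j) 1) = 0
     \<and> (\<forall>j. D01 (u j) 0 = h j * u j 0)"

text \<open>Graph of L_h: L_opr h u f means u \<in> dom(L_h) and f = -u'' (as elements of L^2,
  i.e. almost everywhere), expressed by u'(x) - u'(0) = integral of (-f) over [0,x].\<close>
definition L_opr :: "('n::finite \<Rightarrow> complex) \<Rightarrow> ('n \<Rightarrow> real \<Rightarrow> complex) \<Rightarrow> ('n \<Rightarrow> real \<Rightarrow> complex) \<Rightarrow> bool" where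
  "L_opr h u f \<longleftrightarrow> dom_L h u \<and> (\<forall>j. sq_int (f j))
     \<and> (\<forall>j. \<forall>x\<in>{0..1}. ((\<lambda>t. - f j t) has_integral (D01 (u j) x - D01 (u j) 0)) {0..x})"

text \<open>Spectrum of L_h, which consists of eigenvalues: \<lambda> such that L_h u = \<lambda> u for some
  nonzero u in the domain (u continuous, so nonzero in L^2 iff nonzero somewhere on [0,1]).\<close>
definition spec_L :: "('n::finite \<Rightarrow> complex) \<Rightarrow> complex set" where
  "spec_L h = {z. \<exists>u. (\<exists>j. \<exists>x\<in>{0..1}. u j x \<noteq> 0) \<and> L_opr h u (\<lambda>j t. z * u j t)}"

definition PT_op :: "('n \<Rightarrow> 'n) \<Rightarrow> ('n \<Rightarrow> real \<Rightarrow> complex) \<Rightarrow> ('n \<Rightarrow> real \<Rightarrow> complex)" where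
  "PT_op \<sigma> u = (\<lambda>k t. cnj (u (\<sigma> k) t))"

definition PT_symmetric :: "('n::finite \<Rightarrow> complex) \<Rightarrow> bool" where
  "PT_symmetric h \<longleftrightarrow> (\<exists>\<sigma>. bij \<sigma>
      \<and> (\<forall>u. dom_L h u \<longrightarrow> dom_L h (PT_op \<sigma> u))
      \<and> (\<forall>u f. L_opr h u f \<longrightarrow> L_opr h (PT_op \<sigma> u) (PT_op \<sigma> f)))"

end

theory Submission
  imports Defs "HOL-Complex_Analysis.Great_Picard" "HOL-Real_Asymp.Real_Asymp"
    "HOL-Combinatorics.Permutations" "HOL-Computational_Algebra.Fundamental_Theorem_Algebra"
begin

text \<open>
  Let \<open>p(X) = (X + h\<^sub>1) \<cdots> (X + h\<^sub>N)\<close>. For \<open>sin k \<noteq> 0\<close> and \<open>R = k cot k\<close>, the number \<open>k\<^sup>2\<close> is an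
  eigenvalue iff \<open>N R p(R) = (k\<^sup>2 + R\<^sup>2) p'(R)\<close>. If the spectrum is symmetric, every such pair
  \<open>(k\<^sup>2, R)\<close> also satisfies the equation of the conjugate polynomial \<open>q\<close>, and eliminating \<open>k\<^sup>2\<close>
  gives \<open>R (q p' - p q') (R) = 0\<close>. So infinitely many values of \<open>R\<close> force \<open>q p' = p q'\<close>, hence
  \<open>p = q\<close>, i.e. the multiset of the \<open>h\<^sub>j\<close> is invariant under conjugation.

  To find infinitely many \<open>R\<close>, write \<open>N X p / p' = A / B\<close> in lowest terms. If \<open>B\<close> has a root \<open>\<rho>\<close>,
  Hurwitz's theorem gives solutions of \<open>(k\<^sup>2 + R\<^sup>2) B(R) = A(R)\<close> with \<open>k\<close> near \<open>(n + 1/2) \<pi>\<close> for large \<open>n\<close>.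
  Otherwise \<open>N X p = (X\<^sup>2 + b X + c) p'\<close>, and the equation becomes \<open>(b R + c - k\<^sup>2) p'(R) = 0\<close>. For
  \<open>b \<noteq> 0\<close> Hurwitz's theorem applies near \<open>n \<pi>\<close>. For \<open>b = 0\<close> it suffices that \<open>c\<close> is real: \<open>c\<close> is
  an eigenvalue, and if it is not real, its reflection yields a root \<open>r \<noteq> 0\<close> of \<open>p'\<close>. Such roots satisfy
  \<open>r\<^sup>2 = - c\<close>, and reflecting a large eigenvalue with \<open>k cot k = r\<close> shows that \<open>cnj r\<close> is one
  too, so \<open>c\<close> is real after all.
\<close>

section \<open>Eigenvalues and the secular equation\<close>

lemma D01_eq:
  assumes "(u has_vector_derivative v) (at x within {0..1})" "x \<in> {0..1}"
  shows "D01 u x = v"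
  unfolding D01_def using assms by (intro vector_derivative_within_closed_interval) auto

lemma W22_has_D01:
  assumes "W22 u" "x \<in> {0..1}"
  shows "(u has_vector_derivative D01 u x) (at x within {0..1})"
  using assms D01_eq unfolding W22_def by metis

lemma W22_continuous_on:
  assumes "W22 u"
  shows "continuous_on {0..1} u"
  unfolding continuous_on_eq_continuous_within
  using W22_has_D01[OF assms] has_vector_derivative_continuous by blast

lemma continuous_imp_sq_int:
  assumes "continuous_on {0..1} w"
  shows "sq_int w"
  unfolding sq_int_def using assms by (intro conjI integrable_continuous_real continuous_intros)

text \<open>The fundamental theorem of calculus turns a classical second derivative into the
  integral form in which \<open>W22\<close> and \<open>L_opr\<close> are stated.\<close>

lemma W22_second_derivative:
  assumes u: "\<And>x. x \<in> {0..1} \<Longrightarrow> (u has_vector_derivative v x) (at x within {0..1})"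
    and v: "\<And>x. x \<in> {0..1} \<Longrightarrow> (v has_vector_derivative w x) (at x within {0..1})"
    and w: "continuous_on {0..1} w"
  shows "W22 u" and "\<And>x. x \<in> {0..1} \<Longrightarrow> (w has_integral (D01 u x - D01 u 0)) {0..x}"
proof -
  have int: "(w has_integral (v x - v 0)) {0..x}" if "x \<in> {0..1}" for x
  proof (rule fundamental_theorem_of_calculus)
    show "(v has_vector_derivative w y) (at y within {0..x})" if "y \<in> {0..x}" for y
      using v[of y] that \<open>x \<in> {0..1}\<close> by (auto intro: has_vector_derivative_within_subset)
  qed (use that in auto)
  show "W22 u"
    unfolding W22_def using u int continuous_imp_sq_int[OF w] by blast
  show "(w has_integral (D01 u x - D01 u 0)) {0..x}" if "x \<in> {0..1}" for x
    using int[OF that] D01_eq[OF u] that by simp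
qed

text \<open>The Wronskians with \<open>cos (k x)\<close> and \<open>sin (k x)\<close> are constant, which replaces a
  uniqueness theorem for initial value problems.\<close>
lemma helmholtz_solution:
  fixes u v :: "real \<Rightarrow> complex"
  assumes u: "\<And>x. x \<in> {0..1} \<Longrightarrow> (u has_vector_derivative v x) (at x within {0..1})"
    and v: "\<And>x. x \<in> {0..1} \<Longrightarrow> (v has_vector_derivative - (k\<^sup>2 * u x)) (at x within {0..1})"
    and k: "k \<noteq> 0" and x: "x \<in> {0..1}"
  shows "u x = u 0 * cos (k * x) + v 0 * (sin (k * x) / k)"
    and "v x = v 0 * cos (k * x) - u 0 * (k * sin (k * x))"
proof -
  define a where "a = (\<lambda>x. u x * (k * sin (k * of_real x)) + v x * cos (k * of_real x))"
  define b where "b = (\<lambda>x. u x * (k * cos (k * of_real x)) - v x * sin (k * of_real x))"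
  have s: "((\<lambda>x. sin (k * of_real x)) has_vector_derivative k * cos (k * of_real x)) (at x within S)" for x S
    by (rule has_vector_derivative_at_within, rule has_vector_derivative_real_field) (auto intro!: derivative_eq_intros)
  have c: "((\<lambda>x. cos (k * of_real x)) has_vector_derivative - k * sin (k * of_real x)) (at x within S)" for x S
    by (rule has_vector_derivative_at_within, rule has_vector_derivative_real_field) (auto intro!: derivative_eq_intros)
  have da: "(a has_vector_derivative 0) (at x within {0..1})" if "x \<in> {0..1}" for x
    unfolding a_def
    by (rule has_vector_derivative_eq_rhs)
       (rule has_vector_derivative_add has_vector_derivative_mult u v s c that has_vector_derivative_const
         | simp add: algebra_simps power2_eq_square)+
  have db: "(b has_vector_derivative 0) (at x within {0..1})" if "x \<in> {0..1}" for x
    unfolding b_def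
    by (rule has_vector_derivative_eq_rhs)
       (rule has_vector_derivative_diff has_vector_derivative_mult u v s c that has_vector_derivative_const
         | simp add: algebra_simps power2_eq_square)+
  obtain ca where ca: "\<And>x. x \<in> {0..1} \<Longrightarrow> a x = ca"
    using has_vector_derivative_zero_constant[of "{0..1}" a] da by auto
  obtain cb where cb: "\<And>x. x \<in> {0..1} \<Longrightarrow> b x = cb"
    using has_vector_derivative_zero_constant[of "{0..1}" b] db by auto
  have A: "u x * (k * sin (k * x)) + v x * cos (k * x) = v 0"
    using ca[OF x] ca[of 0] by (simp add: a_def)
  have B: "u x * (k * cos (k * x)) - v x * sin (k * x) = u 0 * k"
    using cb[OF x] cb[of 0] by (simp add: b_def)
  have "k * u x = k * u x * ((sin (k * x))\<^sup>2 + (cos (k * x))\<^sup>2)"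
    by simp
  also have "\<dots> = (u 0 * k) * cos (k * x) + v 0 * sin (k * x)"
    unfolding A[symmetric] B[symmetric] by (simp add: algebra_simps power2_eq_square
        del: sin_cos_squared_add sin_cos_squared_add2 sin_cos_squared_add3)
  finally have "k * u x = (u 0 * k) * cos (k * x) + v 0 * sin (k * x)" .
  with k show "u x = u 0 * cos (k * x) + v 0 * (sin (k * x) / k)"
    by (simp add: field_simps)
  have "v x = v x * ((sin (k * x))\<^sup>2 + (cos (k * x))\<^sup>2)"
    by simp
  also have "\<dots> = v 0 * cos (k * x) - (u 0 * k) * sin (k * x)"
    unfolding A[symmetric] B[symmetric] by (simp add: algebra_simps power2_eq_square
        del: sin_cos_squared_add sin_cos_squared_add2 sin_cos_squared_add3)
  finally have "v x = v 0 * cos (k * x) - (u 0 * k) * sin (k * x)" .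
  then show "v x = v 0 * cos (k * x) - u 0 * (k * sin (k * x))"
    by (simp add: algebra_simps)
qed

text \<open>An eigenfunction is continuous, so the integral identity in \<open>L_opr\<close> can be
  differentiated at every point. This gives the classical equation, and the Robin condition supplies
  the initial slope.\<close>

lemma L_opr_eigenfunction:
  assumes L: "L_opr h u (\<lambda>j t. k\<^sup>2 * u j t)" and k: "k \<noteq> 0" and x: "x \<in> {0..1}"
  shows "u j x = u j 0 * (cos (k * x) + h j * (sin (k * x) / k))"
    and "D01 (u j) x = u j 0 * (h j * cos (k * x) - k * sin (k * x))"
proof -
  have W: "W22 (u j)" and h: "D01 (u j) 0 = h j * u j 0"
    using L by (auto simp: L_opr_def dom_L_def)
  have int: "((\<lambda>t. - (k\<^sup>2 * u j t)) has_integral (D01 (u j) y - D01 (u j) 0)) {0..y}"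
    if "y \<in> {0..1}" for y
    using L that by (auto simp: L_opr_def)
  have "((\<lambda>y. integral {0..y} (\<lambda>t. - (k\<^sup>2 * u j t))) has_vector_derivative - (k\<^sup>2 * u j y))
      (at y within {0..1})" if "y \<in> {0..1}" for y
    using that by (intro integral_has_vector_derivative continuous_intros W22_continuous_on W)
  then have "((\<lambda>y. D01 (u j) y - D01 (u j) 0) has_vector_derivative - (k\<^sup>2 * u j y))
      (at y within {0..1})" if "y \<in> {0..1}" for y
    by (rule has_vector_derivative_transform[rotated -1]) (use that integral_unique[OF int] in auto)
  from has_vector_derivative_add[OF this has_vector_derivative_const, of _ "D01 (u j) 0"]
  have v: "(D01 (u j) has_vector_derivative - (k\<^sup>2 * u j y)) (at y within {0..1})"
    if "y \<in> {0..1}" for y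
    using that by simp
  show "u j x = u j 0 * (cos (k * x) + h j * (sin (k * x) / k))"
    and "D01 (u j) x = u j 0 * (h j * cos (k * x) - k * sin (k * x))"
    using helmholtz_solution[OF W22_has_D01[OF W] v k x] h by (simp_all add: algebra_simps)
qed

text \<open>Converse construction: \<open>a j\<close> is the value at the outer end of edge
  \<open>j\<close>, the Robin condition is built into the formula, and \<open>eq\<close> and
  \<open>kir\<close> are continuity and zero flux at the central vertex.\<close>

lemma L_opr_robin_solution:
  fixes a h :: "'n::finite \<Rightarrow> complex"
  assumes k: "k \<noteq> 0"
    and eq: "\<And>i j. a i * (cos k + h i * (sin k / k)) = a j * (cos k + h j * (sin k / k))"
    and kir: "(\<Sum>j\<in>UNIV. a j * (h j * cos k - k * sin k)) = 0"
  defines "u \<equiv> \<lambda>j x. a j * (cos (k * of_real x) + h j * (sin (k * of_real x) / k))"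
  shows "L_opr h u (\<lambda>j t. k\<^sup>2 * u j t)"
proof -
  define v where "v = (\<lambda>j x. a j * (h j * cos (k * of_real x) - k * sin (k * of_real x)))"
  have du: "(u j has_vector_derivative v j x) (at x within {0..1})" for j x
    unfolding u_def v_def
    by (rule has_vector_derivative_at_within, rule has_vector_derivative_real_field)
       (use k in \<open>auto intro!: derivative_eq_intros simp: field_simps\<close>)
  have dv: "(v j has_vector_derivative - (k\<^sup>2 * u j x)) (at x within {0..1})" for j x
    unfolding u_def v_def
    by (rule has_vector_derivative_at_within, rule has_vector_derivative_real_field)
       (use k in \<open>auto intro!: derivative_eq_intros simp: field_simps power2_eq_square\<close>)
  have cont: "continuous_on {0..1} (\<lambda>x. k\<^sup>2 * u j x)" for j
    unfolding u_def using k by (intro continuous_intros) auto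
  note W = W22_second_derivative[OF du dv continuous_on_minus[OF cont]]
  have D: "D01 (u j) x = v j x" if "x \<in> {0..1}" for j x
    using D01_eq[OF du that] .
  have "dom_L h u"
    unfolding dom_L_def
  proof (intro conjI allI)
    show "u i 1 = u j 1" for i j
      using eq[of i j] by (simp add: u_def)
    show "(\<Sum>j\<in>UNIV. D01 (u j) 1) = 0"
      using kir by (simp add: D v_def)
    show "D01 (u j) 0 = h j * u j 0" for j
      by (simp add: D) (simp add: u_def v_def)
  qed (rule W(1))
  then show ?thesis
    unfolding L_opr_def using W(2) continuous_imp_sq_int[OF cont] by auto
qed

text \<open>Dirichlet-to-Neumann form of the vertex conditions: edge \<open>j\<close> contributes the
  boundary value \<open>x j\<close> and the derivative \<open>y j\<close>. If exactly one \<open>x j\<close> vanishes, both sides fail: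
  the common vertex value is zero, and then so is the whole solution. If two vanish, both sides hold.\<close>
lemma kirchhoff_solvable_iff:
  fixes x y :: "'n::finite \<Rightarrow> 'a::field"
  assumes nz: "\<And>j. x j = 0 \<Longrightarrow> y j \<noteq> 0"
  shows "(\<exists>a. (\<exists>j. a j \<noteq> 0) \<and> (\<forall>i j. a i * x i = a j * x j) \<and> (\<Sum>j\<in>UNIV. a j * y j) = 0)
    \<longleftrightarrow> (\<Sum>j\<in>UNIV. y j * (\<Prod>i\<in>UNIV - {j}. x i)) = 0" (is "?L \<longleftrightarrow> ?R")
proof -
  consider (none) "\<forall>j. x j \<noteq> 0" | (one) m where "x m = 0" "\<forall>j. j \<noteq> m \<longrightarrow> x j \<noteq> 0"
    | (two) m l where "x m = 0" "x l = 0" "m \<noteq> l"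
    by blast
  then show ?thesis
  proof cases
    case none
    have eq: "(\<Sum>j\<in>UNIV. y j * (\<Prod>i\<in>UNIV - {j}. x i)) = prod x UNIV * (\<Sum>j\<in>UNIV. y j / x j)"
      unfolding sum_distrib_left
    proof (rule sum.cong)
      fix j show "y j * (\<Prod>i\<in>UNIV - {j}. x i) = prod x UNIV * (y j / x j)"
        using none prod.remove[of UNIV j x] by simp
    qed simp
    have P: "prod x UNIV \<noteq> 0" using none by simp
    show ?thesis
    proof
      assume ?L
      then obtain a j where a: "a j \<noteq> 0" "\<forall>i j. a i * x i = a j * x j" "(\<Sum>j\<in>UNIV. a j * y j) = 0"
        by blast
      define \<alpha> where "\<alpha> = a j * x j"
      have "\<alpha> \<noteq> 0" using a none by (simp add: \<alpha>_def)
      have "a i = \<alpha> / x i" for i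
        using a(2)[rule_format, of i j] none by (simp add: \<alpha>_def field_simps)
      then have "\<alpha> * (\<Sum>j\<in>UNIV. y j / x j) = 0"
        using a(3) by (simp add: sum_distrib_left)
      with \<open>\<alpha> \<noteq> 0\<close> show ?R by (simp add: eq)
    next
      assume ?R
      then have "(\<Sum>j\<in>UNIV. y j / x j) = 0" using eq P by simp
      then show ?L using none by (intro exI[of _ "\<lambda>j. 1 / x j"]) simp
    qed
  next
    case (one m)
    have "y j * (\<Prod>i\<in>UNIV - {j}. x i) = 0" if "j \<noteq> m" for j
      using one that by (auto intro!: prod_zero bexI[of _ m])
    then have "(\<Sum>j\<in>UNIV. y j * (\<Prod>i\<in>UNIV - {j}. x i)) = y m * (\<Prod>i\<in>UNIV - {m}. x i)"
      by (subst sum.remove[of _ m]) (simp_all add: sum.neutral del: mult_eq_0_iff)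
    then have "\<not> ?R" using one nz by auto
    moreover have "\<not> ?L"
    proof
      assume ?L
      then obtain a j where a: "a j \<noteq> 0" "\<forall>i j. a i * x i = a j * x j" "(\<Sum>j\<in>UNIV. a j * y j) = 0"
        by blast
      have z: "a i = 0" if "i \<noteq> m" for i
        using a(2)[rule_format, of i m] one that by simp
      then have "a m * y m = 0"
        using a(3) by (subst (asm) sum.remove[of _ m]) auto
      with one nz have "a m = 0" by simp
      with z a(1) show False by metis
    qed
    ultimately show ?thesis by simp
  next
    case (two m l)
    have "y j * (\<Prod>i\<in>UNIV - {j}. x i) = 0" for j
      using two by (cases "j = m") auto
    then have ?R by (intro sum.neutral ballI)
    \<comment> \<open>A solution living on edges \<open>m\<close> and \<open>l\<close> only: the
      crossed amplitudes make the two fluxes cancel.\<close>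
    define a where "a = (\<lambda>j. if j = m then y l else if j = l then - y m else 0)"
    have "a i * x i = 0" for i
      using two by (simp add: a_def)
    moreover have "(\<Sum>j\<in>UNIV. a j * y j) = (\<Sum>j\<in>{m, l}. a j * y j)"
      by (rule sum.mono_neutral_right) (auto simp: a_def)
    moreover have "a m \<noteq> 0" using two nz by (simp add: a_def)
    ultimately have ?L using two by (intro exI[of _ a]) (auto simp: a_def)
    with \<open>?R\<close> show ?thesis by simp
  qed
qed

section \<open>The secular equation in the variables k^2 and k cot k\<close>

definition edge_poly :: "('n::finite \<Rightarrow> complex) \<Rightarrow> complex poly" where
  "edge_poly h = (\<Prod>i\<in>UNIV. [:h i, 1:])"

text \<open>The characteristic function of \<open>L\<^sub>h\<close>, divided by \<open>(sin k / k)^N\<close>, as a function of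
  \<open>z = k\<^sup>2\<close> and \<open>R = k cot k\<close>.\<close>
definition secular :: "('n::finite \<Rightarrow> complex) \<Rightarrow> complex \<Rightarrow> complex \<Rightarrow> complex" where
  "secular h z R = of_nat CARD('n) * R * poly (edge_poly h) R
     - (z + R\<^sup>2) * poly (pderiv (edge_poly h)) R"

lemma poly_pderiv_edge_poly:
  "poly (pderiv (edge_poly h)) R = (\<Sum>j\<in>UNIV. \<Prod>i\<in>UNIV - {j}. R + h i)"
  by (simp add: edge_poly_def pderiv_prod poly_sum poly_prod pderiv_pCons add.commute)

text \<open>By the product rule each summand carries the factor
  \<open>R * (R + h j) - (z + R\<^sup>2)\<close>, which collapses to \<open>R * h j - z\<close>. The
  result has the shape of \<open>kirchhoff_solvable_iff\<close>.\<close>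

lemma secular_eq_sum:
  "secular h z R = (\<Sum>j\<in>UNIV. (R * h j - z) * (\<Prod>i\<in>UNIV - {j}. R + h i))"
proof -
  have "poly (edge_poly h) R = (R + h j) * (\<Prod>i\<in>UNIV - {j}. R + h i)" for j
    using prod.remove[of UNIV j "\<lambda>i. R + h i"] by (simp add: edge_poly_def poly_prod add.commute)
  then have "of_nat CARD('a) * R * poly (edge_poly h) R
      = (\<Sum>j\<in>(UNIV::'a set). R * ((R + h j) * (\<Prod>i\<in>UNIV - {j}. R + h i)))"
    by simp
  then show ?thesis
    unfolding secular_def poly_pderiv_edge_poly
    by (simp add: sum_distrib_left sum_subtractf[symmetric] algebra_simps power2_eq_square)
qed

lemma kcot_sq_plus_sq:
  fixes k :: complex
  assumes "sin k \<noteq> 0"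
  shows "k\<^sup>2 + (k * cos k / sin k)\<^sup>2 = k\<^sup>2 / (sin k)\<^sup>2"
  using assms by (simp add: field_simps cos_squared_eq)

text \<open>With the common factor \<open>S = sin k / k\<close> removed, edge \<open>j\<close> has
  boundary value \<open>R + h j\<close> and derivative \<open>R * h j - k\<^sup>2\<close>. They
  cannot vanish together, because \<open>k\<^sup>2 + R\<^sup>2 \<noteq> 0\<close> by
  \<open>kcot_sq_plus_sq\<close>.\<close>

lemma spec_L_iff_secular:
  fixes h :: "'n::finite \<Rightarrow> complex"
  assumes s: "sin k \<noteq> 0"
  shows "k\<^sup>2 \<in> spec_L h \<longleftrightarrow> secular h (k\<^sup>2) (k * cos k / sin k) = 0"
proof -
  have k: "k \<noteq> 0" using s by auto
  define R where "R = k * cos k / sin k"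
  define S where "S = sin k / k"
  have S: "S \<noteq> 0" using s k by (simp add: S_def)
  have x: "cos k + h j * (sin k / k) = S * (R + h j)" for j
    using s k by (simp add: S_def R_def field_simps)
  have y: "h j * cos k - k * sin k = S * (R * h j - k\<^sup>2)" for j
    using s k by (simp add: S_def R_def field_simps power2_eq_square)
  have "R * h j - k\<^sup>2 \<noteq> 0" if "R + h j = 0" for j
  proof -
    have "h j = - R" using that by (simp add: add_eq_0_iff)
    then have "R * h j - k\<^sup>2 = - (k\<^sup>2 + R\<^sup>2)"
      by (simp add: power2_eq_square algebra_simps)
    then show ?thesis using kcot_sq_plus_sq[OF s] s k by (simp add: R_def)
  qed
  note alg = kirchhoff_solvable_iff[of "\<lambda>j. R + h j" "\<lambda>j. R * h j - k\<^sup>2", OF this]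
  have "k\<^sup>2 \<in> spec_L h \<longleftrightarrow> (\<exists>a. (\<exists>j. a j \<noteq> 0) \<and> (\<forall>i j. a i * (R + h i) = a j * (R + h j)) \<and>
     (\<Sum>j\<in>UNIV. a j * (R * h j - k\<^sup>2)) = 0)" (is "_ \<longleftrightarrow> (\<exists>a. ?P a)")
  proof
    assume "k\<^sup>2 \<in> spec_L h"
    then obtain u j t where t: "u j t \<noteq> 0" "t \<in> {0..1}" and L: "L_opr h u (\<lambda>j t. k\<^sup>2 * u j t)"
      by (auto simp: spec_L_def)
    have eq: "u i 1 = u j 1" for i j
      using L by (auto simp: L_opr_def dom_L_def)
    have sum: "(\<Sum>j\<in>UNIV. D01 (u j) 1) = 0"
      using L by (auto simp: L_opr_def dom_L_def)
    have u1: "u i 1 = S * (u i 0 * (R + h i))" and d1: "D01 (u i) 1 = S * (u i 0 * (R * h i - k\<^sup>2))" for i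
      using L_opr_eigenfunction[OF L k, of 1 i] x[of i] y[of i] by (simp_all add: mult.left_commute)
    \<comment> \<open>An eigenfunction that vanishes at the outer end of an edge vanishes on the
      whole edge.\<close>
    have "u j 0 \<noteq> 0"
      using L_opr_eigenfunction(1)[OF L k t(2), of j] t(1) by auto
    then have "?P (\<lambda>j. u j 0)"
      using eq sum S by (auto simp: u1 d1 sum_distrib_left[symmetric])
    then show "\<exists>a. ?P a" by (rule exI[of ?P])
  next
    assume "\<exists>a. ?P a"
    then obtain a j where a: "a j \<noteq> 0" and P: "?P a" by blast
    have eq: "a i * (S * (R + h i)) = a j * (S * (R + h j))" for i j
    proof -
      have "a i * (R + h i) = a j * (R + h j)" using P by blast
      then show ?thesis by (simp add: mult.left_commute[of _ S])
    qed
    have "(\<Sum>j\<in>UNIV. a j * (S * (R * h j - k\<^sup>2))) = S * (\<Sum>j\<in>UNIV. a j * (R * h j - k\<^sup>2))"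
      by (simp add: sum_distrib_left mult_ac)
    then have sum: "(\<Sum>j\<in>UNIV. a j * (S * (R * h j - k\<^sup>2))) = 0" using P by simp
    have "L_opr h (\<lambda>j x. a j * (cos (k * of_real x) + h j * (sin (k * of_real x) / k)))
        (\<lambda>j t. k\<^sup>2 * (a j * (cos (k * of_real t) + h j * (sin (k * of_real t) / k))))"
      by (rule L_opr_robin_solution[OF k]) (use eq sum x y in simp_all)
    then show "k\<^sup>2 \<in> spec_L h"
      unfolding spec_L_def mem_Collect_eq
      by (intro exI conjI) (use a in \<open>auto intro!: bexI[of _ 0]\<close>)
  qed
  also have "\<dots> \<longleftrightarrow> secular h (k\<^sup>2) R = 0"
    by (simp add: alg secular_eq_sum)
  finally show ?thesis unfolding R_def .
qed

section \<open>Large frequencies with prescribed \<open>k cot k\<close>\<close>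

text \<open>Uniform continuity on the compact product gives uniform convergence of
  \<open>\<Phi> w (s n)\<close> to \<open>\<Phi> w 0\<close>. If no approximant had a zero,
  Hurwitz's theorem would forbid the zero of the limit at \<open>a\<close>.\<close>

lemma hurwitz_parameter:
  fixes \<Phi> :: "complex \<Rightarrow> complex \<Rightarrow> complex"
  assumes r: "0 < r" and d: "0 < d"
    and cont: "continuous_on (cball a r \<times> cball 0 d) (\<lambda>(w, s). \<Phi> w s)"
    and hol: "\<And>s. s \<in> cball 0 d \<Longrightarrow> (\<lambda>w. \<Phi> w s) holomorphic_on ball a r"
    and zero: "\<Phi> a 0 = 0"
    and nonconst: "\<not> (\<lambda>w. \<Phi> w 0) constant_on ball a r"
    and s: "\<And>n. s n \<in> cball 0 d" "s \<longlonglongrightarrow> 0"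
  shows "\<exists>n. \<exists>w\<in>ball a r. \<Phi> w (s n) = 0"
proof (rule ccontr)
  assume neg: "\<not> ?thesis"
  have uc: "uniformly_continuous_on (cball a r \<times> cball 0 d) (\<lambda>(w, s). \<Phi> w s)"
    by (intro compact_uniformly_continuous cont compact_Times) auto
  have ul: "uniform_limit (ball a r) (\<lambda>n w. \<Phi> w (s n)) (\<lambda>w. \<Phi> w 0) sequentially"
  proof (rule uniform_limitI)
    fix e :: real assume "0 < e"
    then obtain \<delta> where \<delta>: "\<delta> > 0" and
      close: "\<And>p q. p \<in> cball a r \<times> cball 0 d \<Longrightarrow> q \<in> cball a r \<times> cball 0 d \<Longrightarrow> dist p q < \<delta> \<Longrightarrow>
        dist ((\<lambda>(w, s). \<Phi> w s) p) ((\<lambda>(w, s). \<Phi> w s) q) < e"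
      using uc unfolding uniformly_continuous_on_def by metis
    have "\<forall>\<^sub>F n in sequentially. dist (s n) 0 < \<delta>"
      using tendstoD[OF s(2) \<delta>] .
    then show "\<forall>\<^sub>F n in sequentially. \<forall>w\<in>ball a r. dist (\<Phi> w (s n)) (\<Phi> w 0) < e"
    proof eventually_elim
      case (elim n)
      show ?case
      proof
        fix w assume "w \<in> ball a r"
        then show "dist (\<Phi> w (s n)) (\<Phi> w 0) < e"
          using close[of "(w, s n)" "(w, 0)"] elim s(1)[of n] d by (simp add: dist_Pair_Pair)
      qed
    qed
  qed
  have "\<Phi> a 0 \<noteq> 0"
  proof (rule Hurwitz_no_zeros[of "ball a r" "\<lambda>n w. \<Phi> w (s n)" "\<lambda>w. \<Phi> w 0" a])
    show "(\<lambda>w. \<Phi> w (s n)) holomorphic_on ball a r" for n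
      by (rule hol) (rule s(1))
    show "(\<lambda>w. \<Phi> w 0) holomorphic_on ball a r"
      by (rule hol) (use d in auto)
    show "uniform_limit K (\<lambda>n w. \<Phi> w (s n)) (\<lambda>w. \<Phi> w 0) sequentially" if "K \<subseteq> ball a r" for K
      using ul that by (rule uniform_limit_on_subset)
    show "\<Phi> w (s n) \<noteq> 0" if "w \<in> ball a r" for n w
      using neg that by blast
  qed (use r nonconst in auto)
  with zero show False by simp
qed

section \<open>The limit of infinite frequency\<close>

definition csinc :: "complex \<Rightarrow> complex" where
  "csinc z = (if z = 0 then 1 else sin z / z)"

lemma csinc_mult: "csinc z * z = sin z"
  by (simp add: csinc_def)

lemma continuous_on_csinc: "continuous_on S csinc"
proof (rule continuous_at_imp_continuous_on, rule ballI)
  fix z show "isCont csinc z"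
  proof (cases "z = 0")
    case True
    have "((\<lambda>h. sin h / h) \<longlongrightarrow> 1) (at (0::complex))"
      using DERIV_sin[of "0::complex"] by (simp add: DERIV_def)
    then have "(csinc \<longlongrightarrow> 1) (at 0)"
      by (rule Lim_transform_eventually) (auto simp: csinc_def eventually_at_filter)
    with True show ?thesis by (simp add: isCont_def csinc_def)
  next
    case False
    have "\<forall>\<^sub>F w in nhds z. w \<noteq> 0"
      using t1_space_nhds[OF False] .
    then have "\<forall>\<^sub>F w in nhds z. csinc w = sin w / w"
      by eventually_elim (simp add: csinc_def)
    then have "isCont csinc z \<longleftrightarrow> isCont (\<lambda>w. sin w / w) z"
      by (rule isCont_cong)
    with False show ?thesis by (auto intro!: continuous_intros)
  qed
qed

text \<open>All complex zeros of cosine are odd multiples of pi / 2, hence of modulus greater than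
  1.\<close>

lemma complex_cos_nonzero_near_0:
  fixes z :: complex
  assumes "norm z \<le> 1"
  shows "cos z \<noteq> 0"
proof
  assume "cos z = 0"
  then obtain n :: int where "z = complex_of_real (n * pi) + of_real pi / 2"
    unfolding cos_eq_0 by blast
  then have "z = of_real ((2 * n + 1) * pi / 2)" by (simp add: field_simps)
  then have "norm z = \<bar>of_int (2 * n + 1)\<bar> * (pi / 2)"
    by (simp only: norm_of_real) (simp add: abs_mult)
  moreover have "\<bar>2 * n + 1\<bar> \<ge> 1" by presburger
  then have "\<bar>real_of_int (2 * n + 1)\<bar> \<ge> 1" by linarith
  then have "\<bar>real_of_int (2 * n + 1)\<bar> * (pi / 2) \<ge> 1 * (pi / 2)"
    by (intro mult_right_mono) auto
  ultimately show False using assms pi_gt3 by linarith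
qed

text \<open>The frequency \<open>k = \<kappa> + w / \<kappa>\<close> near a large \<open>\<kappa> = 1 / s\<close>, and the function \<open>k tan (w / \<kappa>)\<close>,
  continued to \<open>s = 0\<close> by the value \<open>w\<close>.\<close>
definition ktan :: "complex \<Rightarrow> complex \<Rightarrow> complex" where
  "ktan w s = (1 + w * s\<^sup>2) * (csinc (w * s) * w) / cos (w * s)"

lemma ktan_eq: "s \<noteq> 0 \<Longrightarrow> ktan w s = (1 / s + w * s) * sin (w * s) / cos (w * s)"
  unfolding ktan_def csinc_mult[symmetric]
  \<comment> \<open>Where the cosine vanishes, both quotients are 0 by the convention for
    division.\<close>
  by (cases "cos (w * s) = 0") (simp_all add: field_simps power2_eq_square)

lemma ktan_0: "ktan w 0 = w"
  by (simp add: ktan_def csinc_def)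

context
  fixes a :: complex and d :: real
  assumes d: "d = 1 / (2 * (norm a + 1))"
begin

text \<open>The radius \<open>d\<close> satisfies \<open>(norm a + 1) * d = 1 / 2\<close>. This
  keeps \<open>w * s\<close> in a disc where cosine has no zeros and
  \<open>1 + w * s\<^sup>2\<close> away from 0.\<close>

lemma parameter_bounds:
  assumes "w \<in> cball a 1" "s \<in> cball 0 d"
  shows "norm (w * s) \<le> 1 / 2" "norm s \<le> 1 / 2" "norm (w * s\<^sup>2) \<le> 1 / 2"
proof -
  have "norm w \<le> norm a + 1"
    using assms(1) norm_triangle_ineq2[of w a] by (simp add: dist_norm norm_minus_commute)
  then have "norm (w * s) \<le> (norm a + 1) * d"
    unfolding norm_mult using assms(2) by (intro mult_mono) (auto simp: dist_norm)
  also have "\<dots> = 1 / 2" by (simp add: d field_simps) (smt (verit) norm_ge_zero)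
  finally show 1: "norm (w * s) \<le> 1 / 2" .
  have "d \<le> 1 / 2" unfolding d by (rule frac_le) auto
  then show 2: "norm s \<le> 1 / 2" using assms(2) by (simp add: dist_norm)
  have "norm (w * s\<^sup>2) = norm (w * s) * norm s" by (simp add: norm_mult power2_eq_square)
  also have "\<dots> \<le> 1 / 2 * 1" using 1 2 by (intro mult_mono) auto
  finally show "norm (w * s\<^sup>2) \<le> 1 / 2" by simp
qed

lemma cos_parameter_nonzero: "w \<in> cball a 1 \<Longrightarrow> s \<in> cball 0 d \<Longrightarrow> cos (w * s) \<noteq> 0"
  using parameter_bounds(1) complex_cos_nonzero_near_0[of "w * s"] by fastforce

lemma frequency_parameter_nonzero: "w \<in> cball a 1 \<Longrightarrow> s \<in> cball 0 d \<Longrightarrow> 1 + w * s\<^sup>2 \<noteq> 0"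
proof
  assume "w \<in> cball a 1" "s \<in> cball 0 d" "1 + w * s\<^sup>2 = 0"
  moreover from this have "w * s\<^sup>2 = - 1" by (simp add: add_eq_0_iff)
  ultimately show False using parameter_bounds(3)[of w s] by simp
qed

lemma continuous_on_ktan: "continuous_on (cball a 1 \<times> cball 0 d) (\<lambda>p. ktan (fst p) (snd p))"
  unfolding ktan_def
  by (intro continuous_intros continuous_on_compose2[OF continuous_on_csinc[of UNIV]])
     (use cos_parameter_nonzero in \<open>auto simp del: mem_cball\<close>)

lemma holomorphic_on_ktan:
  assumes "s \<in> cball 0 d"
  shows "(\<lambda>w. ktan w s) holomorphic_on ball a 1"
proof (cases "s = 0")
  case True
  then show ?thesis by (simp add: ktan_0)
next
  case False
  then show ?thesis unfolding ktan_eq[OF False]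
    by (intro holomorphic_intros) (use cos_parameter_nonzero assms in auto)
qed

lemma frequency_lower_bound:
  assumes "w \<in> cball a 1" "s \<in> cball 0 d" "s \<noteq> 0"
  shows "norm (1 / s + w * s) \<ge> 1 / (2 * norm s)"
proof -
  have "1 / s + w * s = (1 + w * s\<^sup>2) / s"
    using assms(3) by (simp add: field_simps power2_eq_square)
  moreover have "norm (1 + w * s\<^sup>2) \<ge> 1 / 2"
    using parameter_bounds(3)[OF assms(1,2)] norm_triangle_ineq2[of 1 "- (w * s\<^sup>2)"] by simp
  then have "norm (1 + w * s\<^sup>2) / norm s \<ge> 1 / 2 / norm s"
    by (rule divide_right_mono) simp
  ultimately show ?thesis by (simp add: norm_divide)
qed

end

lemma ex_large_zero:
  fixes \<Phi> :: "complex \<Rightarrow> complex \<Rightarrow> complex" and \<kappa> :: "nat \<Rightarrow> real"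
  assumes d: "d = 1 / (2 * (norm a + 1))"
    and cont: "continuous_on (cball a 1 \<times> cball 0 d) (\<lambda>p. \<Phi> (fst p) (snd p))"
    and hol: "\<And>s. s \<in> cball 0 d \<Longrightarrow> (\<lambda>w. \<Phi> w s) holomorphic_on ball a 1"
    and zero: "\<Phi> a 0 = 0"
    and nonconst: "\<not> (\<lambda>w. \<Phi> w 0) constant_on ball a 1"
    and \<kappa>: "filterlim \<kappa> at_top sequentially"
  obtains n w s where "s = complex_of_real (1 / \<kappa> n)" "s \<noteq> 0" "w \<in> cball a 1" "s \<in> cball 0 d"
    "norm (1 / s + w * s) > K" "\<Phi> w s = 0"
proof -
  have d0: "d > 0" using d by (simp add: add_pos_pos add_nonneg_pos)
  \<comment> \<open>The bound \<open>1 / d\<close> puts \<open>1 / \<kappa> n\<close> into the disc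
    of radius \<open>d\<close>; the bound on \<open>K\<close> makes \<open>\<kappa> n / 2\<close>, a
    lower bound for the modulus of the frequency, exceed \<open>K\<close>.\<close>
  obtain n0 where n0: "\<And>n. n \<ge> n0 \<Longrightarrow> \<kappa> n > max (1 / d) (2 * \<bar>K\<bar>)"
    using \<kappa> unfolding filterlim_at_top_dense eventually_sequentially by blast
  have pos: "\<kappa> n > 0" if "n \<ge> n0" for n
    using n0[OF that] by (smt (verit) max.bounded_iff abs_ge_zero max_less_iff_conj)
  have small: "of_real (1 / \<kappa> n) \<in> cball (0::complex) d" if "n \<ge> n0" for n
    using n0[OF that] pos[OF that] d0 by (simp add: norm_divide field_simps)
  have "(\<lambda>n. complex_of_real (1 / \<kappa> (n + n0))) \<longlonglongrightarrow> of_real 0"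
    by (intro tendsto_of_real tendsto_divide_0[OF tendsto_const] filterlim_at_top_imp_at_infinity
        LIMSEQ_ignore_initial_segment[unfolded filterlim_def] \<kappa>
        filterlim_compose[OF \<kappa> filterlim_add_const_nat_at_top])
  then have lim: "(\<lambda>n. complex_of_real (1 / \<kappa> (n + n0))) \<longlonglongrightarrow> 0" by simp
  obtain n w where w: "w \<in> ball a 1" and z: "\<Phi> w (of_real (1 / \<kappa> (n + n0))) = 0"
    using hurwitz_parameter[of 1 d a \<Phi> "\<lambda>n. complex_of_real (1 / \<kappa> (n + n0))"] d0 cont hol zero nonconst lim small
    by (auto simp: case_prod_unfold)
  have \<kappa>0: "\<kappa> (n + n0) > 0" by (rule pos) simp
  have "norm (1 / complex_of_real (1 / \<kappa> (n + n0)) + w * of_real (1 / \<kappa> (n + n0)))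
      \<ge> 1 / (2 * norm (complex_of_real (1 / \<kappa> (n + n0))))"
    by (rule frequency_lower_bound[OF d]) (use w small \<kappa>0 in auto)
  moreover have "1 / (2 * norm (complex_of_real (1 / \<kappa> (n + n0)))) = \<kappa> (n + n0) / 2"
    using \<kappa>0 by (simp add: norm_divide)
  moreover have "\<kappa> (n + n0) / 2 > K" using n0[of "n + n0"] by auto
  ultimately show ?thesis
    using that[OF refl, of "n + n0" w] \<kappa>0 w z small[of "n + n0"] by simp
qed

text \<open>Near (n + 1/2) pi the function cot is a shifted - tan, so k cot k is close to -w.
  Multiplied by s^2, the equation tends to B(-w) = 0 as s -> 0, which has the solution w =
  -\<open>\<rho>\<close>.\<close>

lemma ex_large_frequency_near_cot_zero:
  fixes A B :: "complex poly"
  assumes \<rho>: "poly B \<rho> = 0" and B: "B \<noteq> 0"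
  obtains k where "sin k \<noteq> 0" "norm k > K"
    "(k\<^sup>2 + (k * cos k / sin k)\<^sup>2) * poly B (k * cos k / sin k) = poly A (k * cos k / sin k)"
proof -
  define a where "a = - \<rho>"
  define d where "d = 1 / (2 * (norm a + 1))"
  define \<Phi> where "\<Phi> = (\<lambda>w s. ((1 + w * s\<^sup>2)\<^sup>2 + s\<^sup>2 * (ktan w s)\<^sup>2) * poly B (- ktan w s)
      - s\<^sup>2 * poly A (- ktan w s))"
  define \<kappa> where "\<kappa> = (\<lambda>n::nat. (real n + 1 / 2) * pi)"
  have nonconst: "\<not> (\<lambda>w. \<Phi> w 0) constant_on ball a 1"
  proof
    assume "(\<lambda>w. \<Phi> w 0) constant_on ball a 1"
    then obtain c where "\<And>w. w \<in> ball a 1 \<Longrightarrow> poly B (- w) = c"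
      by (auto simp: constant_on_def \<Phi>_def ktan_0)
    moreover from this[of a] have "c = 0" using \<rho> by (simp add: a_def)
    \<comment> \<open>A constant limit would vanish on the whole ball and give \<open>B\<close>
      infinitely many roots.\<close>
    ultimately have "uminus ` ball a 1 \<subseteq> {x. poly B x = 0}" by auto
    then have "finite (uminus ` ball a 1)"
      using poly_roots_finite[OF B] finite_subset by blast
    then have "finite (ball a 1)"
      by (rule finite_imageD) (simp add: inj_on_def)
    then show False using uncountable_ball[of 1 a] countable_finite by auto
  qed
  have lim: "filterlim \<kappa> at_top sequentially"
    unfolding \<kappa>_def by real_asymp
  have cont: "continuous_on (cball a 1 \<times> cball 0 d) (\<lambda>p. \<Phi> (fst p) (snd p))"
    unfolding \<Phi>_def by (intro continuous_intros continuous_on_ktan d_def)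
  have hol: "(\<lambda>w. \<Phi> w s) holomorphic_on ball a 1" if "s \<in> cball 0 d" for s
    unfolding \<Phi>_def using holomorphic_on_ktan[OF d_def that] by (intro holomorphic_intros)
  have zero: "\<Phi> a 0 = 0" using \<rho> by (simp add: \<Phi>_def ktan_0 a_def)
  obtain n w s where s: "s = complex_of_real (1 / \<kappa> n)" and s0: "s \<noteq> 0"
      and ws: "w \<in> cball a 1" "s \<in> cball 0 d"
      and n: "norm (1 / s + w * s) > K" "\<Phi> w s = 0"
    using cont hol zero nonconst lim by (rule ex_large_zero[OF d_def, of \<Phi> \<kappa> K])
  define k where "k = 1 / s + w * s"
  have k': "k = \<kappa> n + w * s" "norm k > K" using n by (simp_all add: k_def s)
  have "cos (\<kappa> n) = 0" "sin (\<kappa> n) \<noteq> 0"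
    by (simp_all add: \<kappa>_def distrib_right cos_add sin_add)
  then have \<kappa>cs: "cos (complex_of_real (\<kappa> n)) = 0" "sin (complex_of_real (\<kappa> n)) \<noteq> 0"
    by (simp_all only: cos_of_real sin_of_real of_real_eq_0_iff not_False_eq_True)
  have c0: "cos (w * s) \<noteq> 0"
    by (rule cos_parameter_nonzero[OF d_def ws])
  have cs: "cos k = - (sin (complex_of_real (\<kappa> n)) * sin (w * s))"
       "sin k = sin (complex_of_real (\<kappa> n)) * cos (w * s)"
    unfolding k' by (simp_all add: cos_add sin_add \<kappa>cs)
  have R: "k * cos k / sin k = - ktan w s"
    using \<kappa>cs c0 by (simp add: ktan_eq[OF s0, of w, folded k_def] cs)
  have "s\<^sup>2 * ((k\<^sup>2 + (ktan w s)\<^sup>2) * poly B (- ktan w s) - poly A (- ktan w s))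
     = ((s * k)\<^sup>2 + s\<^sup>2 * (ktan w s)\<^sup>2) * poly B (- ktan w s) - s\<^sup>2 * poly A (- ktan w s)"
    by (simp add: algebra_simps)
  also have "s * k = 1 + w * s\<^sup>2"
    using s0 by (simp add: k_def algebra_simps power2_eq_square)
  also have "((1 + w * s\<^sup>2)\<^sup>2 + s\<^sup>2 * (ktan w s)\<^sup>2) * poly B (- ktan w s) - s\<^sup>2 * poly A (- ktan w s) = 0"
    using n(2) by (simp add: \<Phi>_def)
  finally have "(k\<^sup>2 + (ktan w s)\<^sup>2) * poly B (- ktan w s) = poly A (- ktan w s)"
    using s0 by simp
  moreover have "sin k \<noteq> 0" using \<kappa>cs c0 by (simp add: cs(2))
  ultimately show ?thesis
    using that[of k] k'(2) by (simp add: R)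
qed

text \<open>Near n pi the quantity k tan k is close to w. Multiplied by tan k / k, the equation
  becomes k tan k = b + c (k tan k) / k^2, whose limit is w = b.\<close>

lemma ex_large_frequency_near_tan_zero:
  fixes b c :: complex
  assumes b: "b \<noteq> 0"
  obtains k where "sin k \<noteq> 0" "norm k > K" "k\<^sup>2 = b * (k * cos k / sin k) + c"
proof -
  define a where "a = b"
  define d where "d = 1 / (2 * (norm a + 1))"
  define \<Phi> where "\<Phi> = (\<lambda>w s. ktan w s - b - c * (s\<^sup>2 * ktan w s / (1 + w * s\<^sup>2)\<^sup>2))"
  define \<kappa> where "\<kappa> = (\<lambda>n::nat. real n * pi)"
  have nonconst: "\<not> (\<lambda>w. \<Phi> w 0) constant_on ball a 1"
  proof
    assume "(\<lambda>w. \<Phi> w 0) constant_on ball a 1"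
    then obtain c where "\<And>w. w \<in> ball a 1 \<Longrightarrow> w - b = c"
      by (auto simp: constant_on_def \<Phi>_def ktan_0)
    from this[of a] this[of "a + 1 / 2"] have "(a + 1 / 2 - b) - (a - b) = 0"
      by (simp add: dist_norm norm_divide)
    then show False by simp
  qed
  have lim: "filterlim \<kappa> at_top sequentially"
    unfolding \<kappa>_def by real_asymp
  have cont: "continuous_on (cball a 1 \<times> cball 0 d) (\<lambda>p. \<Phi> (fst p) (snd p))"
    unfolding \<Phi>_def
    by (intro continuous_intros continuous_on_ktan d_def)
       (use frequency_parameter_nonzero[OF d_def] in \<open>auto simp del: mem_cball\<close>)
  have hol: "(\<lambda>w. \<Phi> w s) holomorphic_on ball a 1" if "s \<in> cball 0 d" for s
    unfolding \<Phi>_def using holomorphic_on_ktan[OF d_def that]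
    by (intro holomorphic_intros) (use frequency_parameter_nonzero[OF d_def _ that] in auto)
  have zero: "\<Phi> a 0 = 0" by (simp add: \<Phi>_def ktan_0 a_def)
  obtain n w s where s: "s = complex_of_real (1 / \<kappa> n)" and s0: "s \<noteq> 0"
      and ws: "w \<in> cball a 1" "s \<in> cball 0 d"
      and n: "norm (1 / s + w * s) > K" "\<Phi> w s = 0"
    using cont hol zero nonconst lim by (rule ex_large_zero[OF d_def, of \<Phi> \<kappa> K])
  define k where "k = 1 / s + w * s"
  define q where "q = ktan w s"
  have k': "k = \<kappa> n + w * s" "norm k > K" using n by (simp_all add: k_def s)
  have "sin (\<kappa> n) = 0" "cos (\<kappa> n) \<noteq> 0"
    by (simp_all add: \<kappa>_def cos_npi)
  then have \<kappa>cs: "sin (complex_of_real (\<kappa> n)) = 0" "cos (complex_of_real (\<kappa> n)) \<noteq> 0"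
    by (simp_all only: cos_of_real sin_of_real of_real_eq_0_iff not_False_eq_True)
  have c0: "cos (w * s) \<noteq> 0"
    by (rule cos_parameter_nonzero[OF d_def ws])
  have cs: "sin k = cos (complex_of_real (\<kappa> n)) * sin (w * s)"
       "cos k = cos (complex_of_real (\<kappa> n)) * cos (w * s)"
    unfolding k' by (simp_all add: cos_add sin_add \<kappa>cs)
  have sk: "1 + w * s\<^sup>2 = s * k"
    using s0 by (simp add: k_def algebra_simps power2_eq_square)
  have k0: "k \<noteq> 0" using frequency_parameter_nonzero[OF d_def ws] by (auto simp: sk)
  have q: "q = k * sin k / cos k"
    using \<kappa>cs c0 by (simp add: q_def ktan_eq[OF s0, of w, folded k_def] cs)
  have "q - b - c * (s\<^sup>2 * q / (s * k)\<^sup>2) = 0"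
    using n(2) by (simp add: \<Phi>_def q_def sk)
  then have eq: "q * k\<^sup>2 = b * k\<^sup>2 + c * q"
    using s0 k0 by (simp add: field_simps power_mult_distrib)
  have "q \<noteq> 0" using eq b k0 by auto
  then have sin: "sin k \<noteq> 0" by (auto simp: q)
  have cos: "cos k \<noteq> 0" using \<kappa>cs c0 by (simp add: cs)
  have "k\<^sup>2 = b * (k\<^sup>2 / q) + c"
    using eq \<open>q \<noteq> 0\<close> by (simp add: field_simps)
  also have "k\<^sup>2 / q = k * cos k / sin k"
    using sin cos k0 by (simp add: q power2_eq_square)
  finally show ?thesis using that sin k'(2) by blast
qed

section \<open>Symmetry of the edge polynomial\<close>

lemma degree_edge_poly: "degree (edge_poly (h :: 'n::finite \<Rightarrow> complex)) = CARD('n)"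
  by (simp add: edge_poly_def degree_prod_eq_sum_degree)

lemma lead_coeff_edge_poly: "lead_coeff (edge_poly h) = 1"
  unfolding edge_poly_def lead_coeff_prod by simp

lemma edge_poly_nonzero: "edge_poly h \<noteq> 0"
  using lead_coeff_edge_poly[of h] by auto

lemma pderiv_edge_poly_nonzero: "pderiv (edge_poly h) \<noteq> 0"
  using degree_edge_poly[of h] by (simp add: pderiv_eq_0_iff)

lemma poly_edge_poly_cnj: "poly (edge_poly (\<lambda>i. cnj (h i))) R = cnj (poly (edge_poly h) (cnj R))"
  by (simp add: edge_poly_def poly_prod)

lemma poly_pderiv_edge_poly_cnj:
  "poly (pderiv (edge_poly (\<lambda>i. cnj (h i)))) R = cnj (poly (pderiv (edge_poly h)) (cnj R))"
  by (simp add: poly_pderiv_edge_poly)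

lemma secular_cnj: "secular (\<lambda>i. cnj (h i)) z R = cnj (secular h (cnj z) (cnj R))"
  by (simp add: secular_def poly_edge_poly_cnj poly_pderiv_edge_poly_cnj)

text \<open>The roots of \<open>edge_poly h\<close>, with multiplicity, are the numbers
  \<open>- h i\<close>; equal multisets of values differ by a permutation of the indices.\<close>

lemma edge_poly_eq_imp_permutation:
  fixes g h :: "'n::finite \<Rightarrow> complex"
  assumes "edge_poly g = edge_poly h"
  obtains \<sigma> where "bij \<sigma>" "\<And>i. h (\<sigma> i) = g i"
proof -
  have proots: "proots (edge_poly f) = image_mset uminus (image_mset f (mset_set UNIV))"
    for f :: "'n \<Rightarrow> complex"
    unfolding edge_poly_def
    by (subst proots_prod) (simp_all add: multiset.map_comp o_def sum_unfold_sum_mset)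
  have "image_mset uminus (image_mset g (mset_set UNIV)) = image_mset uminus (image_mset h (mset_set UNIV))"
    using assms proots[of g] proots[of h] by simp
  then have "image_mset uminus (image_mset uminus (image_mset g (mset_set UNIV)))
      = image_mset uminus (image_mset uminus (image_mset h (mset_set UNIV)))"
    by simp
  then have "image_mset g (mset_set UNIV) = image_mset h (mset_set UNIV)"
    by (simp add: multiset.map_comp o_def)
  then obtain p where "p permutes UNIV" "\<forall>x\<in>UNIV. g x = h (p x)"
    using image_mset_eq_implies_permutes[of UNIV g h] by auto
  then show ?thesis using that[of p] permutes_bij by auto
qed

text \<open>\<open>p d' = p' d\<close> for \<open>d = p - q\<close>, and the leading coefficients of the two sides carry the
  factors \<open>deg d < deg p\<close> and \<open>deg p\<close>.\<close>
lemma monic_wronskian_zero_imp_eq: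
  fixes p q :: "'a::field_char_0 poly"
  assumes monic: "lead_coeff p = 1" "lead_coeff q = 1" and deg: "degree p = degree q"
    and W: "p * pderiv q = q * pderiv p"
  shows "p = q"
proof (rule ccontr)
  assume "p \<noteq> q"
  define d where "d = p - q"
  have d: "d \<noteq> 0" using \<open>p \<noteq> q\<close> by (simp add: d_def)
  have deg_d: "degree d < degree p"
  proof (rule ccontr)
    assume "\<not> ?thesis"
    moreover have "degree d \<le> degree p" unfolding d_def using deg by (intro degree_diff_le) auto
    ultimately have "degree d = degree p" by simp
    then have "lead_coeff d = 0" using monic deg by (simp add: d_def)
    with d show False by simp
  qed
  have "p * pderiv d = d * pderiv p"
    using W by (simp add: d_def pderiv_diff algebra_simps)
  then have "lead_coeff (p * pderiv d) = lead_coeff (d * pderiv p)" by simp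
  moreover have "lead_coeff (pderiv f) = of_nat (degree f) * lead_coeff f" for f :: "'a poly"
    by (cases "degree f") (auto simp: coeff_pderiv degree_pderiv pderiv_eq_0_iff coeff_eq_0)
  ultimately have "of_nat (degree d) * lead_coeff d = of_nat (degree p) * lead_coeff d"
    using monic by (simp add: lead_coeff_mult)
  with d deg_d show False by simp
qed

text \<open>Induction on the degree of \<open>q\<close>, splitting off a linear factor for each
  common root.\<close>

lemma ex_lowest_terms:
  fixes p q :: "'a::field poly"
  assumes "q \<noteq> 0"
  shows "\<exists>a b d. p = a * d \<and> q = b * d \<and> (\<forall>x. poly a x \<noteq> 0 \<or> poly b x \<noteq> 0)"
  using assms
proof (induction "degree q" arbitrary: p q rule: less_induct)
  case less
  show ?case
  proof (cases "\<exists>x. poly p x = 0 \<and> poly q x = 0")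
    case False
    then show ?thesis by (intro exI[of _ p] exI[of _ q] exI[of _ 1]) auto
  next
    case True
    then obtain x p' q' where pq: "p = [:- x, 1:] * p'" "q = [:- x, 1:] * q'"
      by (auto simp: poly_eq_0_iff_dvd dvd_def simp del: mult_pCons_left)
    then have "q' \<noteq> 0" using less.prems by auto
    then have "degree q = Suc (degree q')"
      using degree_mult_eq[of "[:- x, 1:]" q'] pq(2) by (simp del: mult_pCons_left)
    then obtain a b d where "p' = a * d" "q' = b * d" "\<forall>x. poly a x \<noteq> 0 \<or> poly b x \<noteq> 0"
      using less.hyps[of q' p'] \<open>q' \<noteq> 0\<close> by auto
    then have "p = a * ([:- x, 1:] * d) \<and> q = b * ([:- x, 1:] * d)
        \<and> (\<forall>x. poly a x \<noteq> 0 \<or> poly b x \<noteq> 0)"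
      unfolding pq by (simp only: mult.left_commute simp_thms)
    then show ?thesis by blast
  qed
qed

text \<open>Multiply each equation by the derivative from the other and subtract: the terms with
  \<open>z + R\<^sup>2\<close> cancel, and the factor \<open>CARD('n)\<close> is nonzero.\<close>

lemma secular_common_zero:
  fixes g h :: "'n::finite \<Rightarrow> complex"
  assumes "secular g z R = 0" "secular h z R = 0"
  shows "R * poly (edge_poly g * pderiv (edge_poly h) - edge_poly h * pderiv (edge_poly g)) R = 0"
proof -
  let ?p = "poly (edge_poly g) R" and ?q = "poly (edge_poly h) R"
  let ?p' = "poly (pderiv (edge_poly g)) R" and ?q' = "poly (pderiv (edge_poly h)) R"
  have "of_nat CARD('n) * R * ?p = (z + R\<^sup>2) * ?p'" "of_nat CARD('n) * R * ?q = (z + R\<^sup>2) * ?q'"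
    using assms by (simp_all add: secular_def)
  then have "of_nat CARD('n) * (R * (?p * ?q' - ?q * ?p')) = 0" by algebra
  then show ?thesis by simp
qed

section \<open>Consequences of a reflection-symmetric spectrum\<close>

context
  fixes h :: "'n::finite \<Rightarrow> complex"
  assumes sym: "\<And>z. z \<in> spec_L h \<longleftrightarrow> cnj z \<in> spec_L h"
begin

lemma secular_zero_reflected:
  assumes k: "sin k \<noteq> 0" and R: "R = k * cos k / sin k" and 0: "secular h (k\<^sup>2) R = 0"
  shows "secular h (cnj (k\<^sup>2)) (cnj R) = 0"
proof -
  have "cnj (k\<^sup>2) \<in> spec_L h"
    using sym[of "k\<^sup>2"] spec_L_iff_secular[OF k, of h] 0 R by blast
  then have "(cnj k)\<^sup>2 \<in> spec_L h" by simp
  moreover have "sin (cnj k) \<noteq> 0" using k by (simp flip: cnj_sin)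
  ultimately have "secular h ((cnj k)\<^sup>2) (cnj k * cos (cnj k) / sin (cnj k)) = 0"
    using spec_L_iff_secular by blast
  then show ?thesis by (simp add: R flip: cnj_sin cnj_cos)
qed

text \<open>If the Wronskian \<open>W\<close> were nonzero, only finitely many values of k cot k
  could occur. As \<open>f\<close> recovers k^2 from k cot k, the frequencies would then be
  bounded.\<close>

lemma edge_poly_self_conjugate_if_unbounded:
  assumes ex: "\<And>K. \<exists>k. sin k \<noteq> 0 \<and> norm k > K \<and> secular h (k\<^sup>2) (k * cos k / sin k) = 0
      \<and> k\<^sup>2 = f (k * cos k / sin k)"
  shows "edge_poly (\<lambda>i. cnj (h i)) = edge_poly h"
proof (rule ccontr)
  define W where "W = edge_poly (\<lambda>i. cnj (h i)) * pderiv (edge_poly h)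
      - edge_poly h * pderiv (edge_poly (\<lambda>i. cnj (h i)))"
  assume "\<not> ?thesis"
  then have "W \<noteq> 0"
    using monic_wronskian_zero_imp_eq[OF lead_coeff_edge_poly lead_coeff_edge_poly, of "\<lambda>i. cnj (h i)" h]
    by (auto simp: W_def degree_edge_poly)
  then have "finite {R. poly ([:0, 1:] * W) R = 0}"
    by (intro poly_roots_finite) (simp only: mult_eq_0_iff pCons_eq_0_iff, simp)
  then have "bounded (f ` {R. poly ([:0, 1:] * W) R = 0})"
    by (intro finite_imp_bounded finite_imageI)
  then obtain M where M: "\<And>R. R * poly W R = 0 \<Longrightarrow> norm (f R) \<le> M"
    by (auto simp: bounded_iff)
  obtain k where k: "sin k \<noteq> 0" "norm k > \<bar>M\<bar> + 1"
    and 0: "secular h (k\<^sup>2) (k * cos k / sin k) = 0" and f: "k\<^sup>2 = f (k * cos k / sin k)"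
    using ex by blast
  have "secular (\<lambda>i. cnj (h i)) (k\<^sup>2) (k * cos k / sin k) = 0"
    using secular_zero_reflected[OF k(1) refl 0] by (simp add: secular_cnj)
  from M[OF secular_common_zero[OF this 0, folded W_def]] f have "norm (k\<^sup>2) \<le> M" by simp
  moreover have "norm k * norm k \<ge> norm k * 1" using k(2) by (intro mult_left_mono) auto
  ultimately show False using k(2) by (simp add: norm_mult power2_eq_square)
qed

lemma edge_poly_self_conjugate:
  "edge_poly (\<lambda>i. cnj (h i)) = edge_poly h"
proof -
  define p where "p = edge_poly h"
  define G where "G = smult (of_nat CARD('n)) ([:0, 1:] * p)"
  have p': "pderiv p \<noteq> 0" unfolding p_def by (rule pderiv_edge_poly_nonzero)
  have p0: "p \<noteq> 0" unfolding p_def by (rule edge_poly_nonzero)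
  have G: "poly G R = of_nat CARD('n) * R * poly p R" for R by (simp add: G_def)
  have secular: "secular h z R = poly G R - (z + R\<^sup>2) * poly (pderiv p) R" for z R
    by (simp add: secular_def G p_def)
  obtain A B D where A: "G = A * D" and B: "pderiv p = B * D" and AB: "\<And>x. poly A x \<noteq> 0 \<or> poly B x \<noteq> 0"
    using ex_lowest_terms[OF p'] by metis
  have B0: "B \<noteq> 0" using B p' by auto
  show ?thesis
  proof (cases "degree B = 0")
    case False
    then obtain \<rho> where \<rho>: "poly B \<rho> = 0"
      using fundamental_theorem_of_algebra[of B] constant_degree[of B] by auto
    show ?thesis
    proof (rule edge_poly_self_conjugate_if_unbounded)
      fix K
      obtain k where k: "sin k \<noteq> 0" "norm k > K" and eq:
        "(k\<^sup>2 + (k * cos k / sin k)\<^sup>2) * poly B (k * cos k / sin k) = poly A (k * cos k / sin k)"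
        using ex_large_frequency_near_cot_zero[OF \<rho> B0] by metis
      let ?R = "k * cos k / sin k"
      \<comment> \<open>If \<open>B\<close> vanished here, so would \<open>A\<close>, against lowest
        terms. Hence k^2 is a function of \<open>?R\<close>.\<close>
      have "poly B ?R \<noteq> 0"
        using AB[of ?R] eq by auto
      then have "k\<^sup>2 = poly A ?R / poly B ?R - ?R\<^sup>2"
        using eq by (simp add: eq_divide_eq eq_diff_eq)
      moreover have "poly G ?R = (k\<^sup>2 + ?R\<^sup>2) * poly (pderiv p) ?R"
        by (simp add: A B flip: eq)
      ultimately show "\<exists>k. sin k \<noteq> 0 \<and> norm k > K \<and> secular h (k\<^sup>2) (k * cos k / sin k) = 0
          \<and> k\<^sup>2 = (\<lambda>R. poly A R / poly B R - R\<^sup>2) (k * cos k / sin k)"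
        using k by (intro exI[of _ k]) (simp add: secular)
    qed
  next
    case True
    then obtain \<beta> where \<beta>: "B = [:\<beta>:]" by (rule degree_eq_zeroE)
    \<comment> \<open>Now p' divides \<open>G\<close>; degrees N + 1 and N - 1 and equal leading
      coefficients make the quotient \<open>Q\<close> a monic quadratic.\<close>
    define Q where "Q = smult (1 / \<beta>) A"
    have \<beta>0: "\<beta> \<noteq> 0" using \<beta> B0 by auto
    have GQ: "G = Q * pderiv p"
      using A B by (simp add: Q_def \<beta> \<beta>0)
    have "Q \<noteq> 0" using GQ p0 by (auto simp: G_def)
    have "degree G = Suc CARD('n)"
      using p0 by (simp add: G_def degree_mult_eq p_def degree_edge_poly)
    then have "degree Q + (CARD('n) - 1) = Suc CARD('n)"
      using degree_mult_eq[OF \<open>Q \<noteq> 0\<close> p'] GQ by (simp add: degree_pderiv p_def degree_edge_poly)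
    moreover have "CARD('n) \<noteq> 0" by simp
    ultimately have degQ: "degree Q = 2" by linarith
    have "lead_coeff G = of_nat CARD('n)"
      unfolding G_def lead_coeff_smult lead_coeff_mult p_def lead_coeff_edge_poly by simp
    moreover have "lead_coeff (pderiv p) = of_nat CARD('n)"
      using lead_coeff_edge_poly[of h]
      by (simp add: degree_pderiv coeff_pderiv p_def degree_edge_poly)
    ultimately have "lead_coeff Q = 1"
      using GQ lead_coeff_mult[of Q "pderiv p"] by simp
    define b c where "b = coeff Q 1" and "c = coeff Q 0"
    have Q: "poly Q R = R\<^sup>2 + b * R + c" for R
      using \<open>lead_coeff Q = 1\<close>
      by (simp add: poly_altdef degQ numeral_2_eq_2 b_def c_def)
    have sec: "secular h z R = (b * R + c - z) * poly (pderiv p) R" for z R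
      by (simp add: secular GQ Q algebra_simps)
    show ?thesis
    proof (cases "b = 0")
      case False
      show ?thesis
      proof (rule edge_poly_self_conjugate_if_unbounded)
        fix K
        obtain k where k: "sin k \<noteq> 0" "norm k > K" "k\<^sup>2 = b * (k * cos k / sin k) + c"
          using ex_large_frequency_near_tan_zero[OF False] by metis
        then show "\<exists>k. sin k \<noteq> 0 \<and> norm k > K \<and> secular h (k\<^sup>2) (k * cos k / sin k) = 0
            \<and> k\<^sup>2 = (\<lambda>R. b * R + c) (k * cos k / sin k)"
          by (intro exI[of _ k]) (simp add: sec)
      qed
    next
      case True
      \<comment> \<open>From \<open>G = Q * pderiv p\<close>, a root \<open>x \<noteq> 0\<close> of
        p' is a root of \<open>p\<close>, with order one higher than in p'. The surplus must come
        from \<open>Q\<close>.\<close>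
      have critical: "x\<^sup>2 = - c" if x: "poly (pderiv p) x = 0" "x \<noteq> 0" for x
      proof -
        have "poly p x = 0"
          using G[of x] x by (simp add: GQ)
        then have "order x p = Suc (order x (pderiv p))"
          using order_pderiv[OF p0] by simp
        moreover have "order x G = order x ([:0, 1:] * p)"
          unfolding G_def by (rule order_smult) simp
        then have "order x G = order x p"
          using p0 x(2) order_mult[of "[:0, 1:]" p x] order_0I[of "[:0, 1:]" x]
          by simp
        moreover have "order x G = order x Q + order x (pderiv p)"
          using GQ \<open>Q \<noteq> 0\<close> p' by (simp add: order_mult)
        ultimately have "order x Q \<noteq> 0" by simp
        then have "poly Q x = 0" by (simp add: order_root)
        then show ?thesis using True by (simp add: Q add_eq_0_iff2)
      qed
      have "cnj c = c"
      proof (rule ccontr)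
        assume c: "cnj c \<noteq> c"
        define k where "k = csqrt c"
        define R where "R = k * cos k / sin k"
        have k2: "k\<^sup>2 = c" by (simp add: k_def)
        \<comment> \<open>Sine and cosine have only real zeros, so both are nonzero at
          \<open>k\<close>.\<close>
        have real: "k \<notin> \<real>"
          using k2 c Reals_power[of k 2] by (auto simp: Reals_cnj_iff)
        have s: "sin k \<noteq> 0" using real by (auto simp: sin_eq_0)
        have co: "cos k \<noteq> 0" using real by (auto simp: cos_eq_0)
        have "secular h (k\<^sup>2) R = 0" using True by (simp add: sec k2)
        from secular_zero_reflected[OF s R_def this]
        \<comment> \<open>The reflected equation reads
          \<open>(c - cnj c) * poly (pderiv p) (cnj R) = 0\<close>.\<close>
        have r: "poly (pderiv p) (cnj R) = 0" using True c by (simp add: sec k2)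
        have r0: "cnj R \<noteq> 0" using s co by (auto simp: R_def)
        \<comment> \<open>With A = 0 and B = X - \<open>cnj R\<close>, the first factor is nonzero
          by \<open>kcot_sq_plus_sq\<close>, so l cot l equals \<open>cnj R\<close> exactly. The
          size of \<open>l\<close> later excludes \<open>c = (cnj l)\<^sup>2\<close>.\<close>
        obtain l where l: "sin l \<noteq> 0" "norm l > norm c + 1"
            "(l\<^sup>2 + (l * cos l / sin l)\<^sup>2) * poly [:- cnj R, 1:] (l * cos l / sin l) = poly 0 (l * cos l / sin l)"
          using ex_large_frequency_near_cot_zero[of "[:- cnj R, 1:]" "cnj R" "norm c + 1" 0] by auto
        have "l \<noteq> 0" using l(1) by auto
        then have lR: "cnj R = l * cos l / sin l"
          using l(1,3) by (simp add: kcot_sq_plus_sq)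
        have "secular h (l\<^sup>2) (cnj R) = 0" using r by (simp add: sec)
        from secular_zero_reflected[OF l(1) lR this]
        have "c = (cnj l)\<^sup>2 \<or> poly (pderiv p) R = 0" using True by (simp add: sec)
        moreover have "c \<noteq> (cnj l)\<^sup>2"
        proof
          assume "c = (cnj l)\<^sup>2"
          then have "norm c = norm l * norm l" by (simp add: norm_mult power2_eq_square)
          moreover have "norm l * norm l \<ge> norm l * 1"
            using l(2) norm_ge_zero[of c] by (intro mult_left_mono; linarith)
          ultimately show False using l(2) by simp
        qed
        ultimately have "R\<^sup>2 = - c" using critical r0 by simp
        moreover have "(cnj R)\<^sup>2 = - c" using critical r r0 by blast
        then have "cnj ((cnj R)\<^sup>2) = - cnj c" by simp
        ultimately show False using c by simp
      qed
      \<comment> \<open>For b = 0 and real \<open>c\<close>, both secular functions vanish at z = c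
        for every \<open>R\<close>, so the Wronskian times X is the zero polynomial.\<close>
      have "secular (\<lambda>i. cnj (h i)) c R = 0" "secular h c R = 0" for R
        using True \<open>cnj c = c\<close> by (simp_all add: secular_cnj sec)
      note W = secular_common_zero[OF this]
      let ?W = "edge_poly (\<lambda>i. cnj (h i)) * pderiv (edge_poly h)
          - edge_poly h * pderiv (edge_poly (\<lambda>i. cnj (h i)))"
      have "poly ([:0, 1:] * ?W) = poly 0"
        using W by (simp add: fun_eq_iff)
      then have "[:0, 1:] * ?W = 0" by (simp only: poly_eq_poly_eq_iff)
      then have "?W = 0" by (simp only: mult_eq_0_iff) simp
      then have "edge_poly (\<lambda>i. cnj (h i)) * pderiv (edge_poly h)
          = edge_poly h * pderiv (edge_poly (\<lambda>i. cnj (h i)))"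
        by (simp only: right_minus_eq)
      then show ?thesis
        by (intro monic_wronskian_zero_imp_eq[OF lead_coeff_edge_poly lead_coeff_edge_poly])
           (simp only: degree_edge_poly)
    qed
  qed
qed

end

section \<open>PT-symmetry\<close>

lemma sq_int_cnj: "sq_int w \<Longrightarrow> sq_int (\<lambda>x. cnj (w x))"
  by (simp add: sq_int_def integrable_on_cnj_iff)

lemma W22_cnj:
  assumes "W22 u"
  shows "W22 (\<lambda>x. cnj (u x))"
proof -
  obtain v w where "\<forall>x\<in>{0..1}. (u has_vector_derivative v x) (at x within {0..1})" "sq_int w"
    "\<forall>x\<in>{0..1}. (w has_integral (v x - v 0)) {0..x}"
    using assms unfolding W22_def by blast
  then show ?thesis
    unfolding W22_def
    by (intro exI[of _ "\<lambda>x. cnj (v x)"] exI[of _ "\<lambda>x. cnj (w x)"])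
       (auto intro!: has_vector_derivative_cnj sq_int_cnj
          simp: has_integral_cnj[unfolded o_def] simp flip: complex_cnj_diff)
qed

lemma D01_cnj:
  assumes "W22 u" "x \<in> {0..1}"
  shows "D01 (\<lambda>x. cnj (u x)) x = cnj (D01 u x)"
  by (rule D01_eq[OF has_vector_derivative_cnj[OF W22_has_D01[OF assms]] assms(2)])

text \<open>Conjugating the Robin condition of edge \<open>\<sigma> k\<close> gives the coefficient
  \<open>cnj (h (\<sigma> k)) = h k\<close> required on edge \<open>k\<close>; the conditions at the
  central vertex are invariant under permutation and conjugation.\<close>

lemma PT_symmetric_if_conjugating_permutation:
  fixes h :: "'n::finite \<Rightarrow> complex"
  assumes \<sigma>: "bij \<sigma>" and h: "\<And>k. h (\<sigma> k) = cnj (h k)"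
  shows "PT_symmetric h"
proof -
  have dom: "dom_L h (PT_op \<sigma> u)" if u: "dom_L h u" for u
  proof -
    have W: "W22 (u j)" for j using u by (simp add: dom_L_def)
    have D: "D01 (PT_op \<sigma> u j) x = cnj (D01 (u (\<sigma> j)) x)" if "x \<in> {0..1}" for j x
      using D01_cnj[OF W that] by (simp add: PT_op_def)
    have "(\<Sum>j\<in>UNIV. D01 (u (\<sigma> j)) 1) = (\<Sum>j\<in>UNIV. D01 (u j) 1)"
      using \<sigma> by (rule sum.reindex_bij_betw)
    also have "\<dots> = 0" using u by (simp add: dom_L_def)
    finally have "(\<Sum>j\<in>UNIV. D01 (PT_op \<sigma> u j) 1) = 0"
      by (simp add: D flip: cnj_sum)
    moreover have "W22 (PT_op \<sigma> u j)" for j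
      using W22_cnj[OF W] by (simp add: PT_op_def)
    moreover have "PT_op \<sigma> u i 1 = PT_op \<sigma> u j 1" for i j
      using u unfolding PT_op_def dom_L_def by metis
    moreover have "D01 (PT_op \<sigma> u j) 0 = h j * PT_op \<sigma> u j 0" for j
      using u by (simp add: D) (simp add: PT_op_def dom_L_def h)
    ultimately show ?thesis by (simp add: dom_L_def)
  qed
  have "L_opr h (PT_op \<sigma> u) (PT_op \<sigma> f)" if L: "L_opr h u f" for u f
  proof -
    have W: "W22 (u j)" for j using L by (simp add: L_opr_def dom_L_def)
    have "((\<lambda>t. - PT_op \<sigma> f j t) has_integral (D01 (PT_op \<sigma> u j) x - D01 (PT_op \<sigma> u j) 0)) {0..x}"
      if "x \<in> {0..1}" for j x
    proof -
      have "((\<lambda>t. - f (\<sigma> j) t) has_integral (D01 (u (\<sigma> j)) x - D01 (u (\<sigma> j)) 0)) {0..x}"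
        using L that by (simp add: L_opr_def)
      from has_integral_cnj[THEN iffD2, OF this] show ?thesis
        using D01_cnj[OF W[of "\<sigma> j"]] that by (simp add: PT_op_def o_def)
    qed
    moreover have "sq_int (PT_op \<sigma> f j)" for j
      using L sq_int_cnj by (simp add: L_opr_def PT_op_def)
    ultimately show ?thesis
      using L dom by (simp add: L_opr_def)
  qed
  with \<sigma> dom show ?thesis unfolding PT_symmetric_def by blast
qed

text \<open>The operator PT is antilinear, so it carries an eigenfunction for \<open>z\<close> to
  one for \<open>cnj z\<close>; surjectivity of \<open>\<sigma>\<close> keeps the image
  nonzero.\<close>

lemma PT_symmetric_imp_spec_L_reflected:
  assumes "PT_symmetric h" "z \<in> spec_L h"
  shows "cnj z \<in> spec_L h"
proof -
  obtain \<sigma> where \<sigma>: "bij \<sigma>" and PT: "\<And>u f. L_opr h u f \<Longrightarrow> L_opr h (PT_op \<sigma> u) (PT_op \<sigma> f)"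
    using assms(1) by (auto simp: PT_symmetric_def)
  obtain u j x where nz: "x \<in> {0..1}" "u j x \<noteq> 0" and L: "L_opr h u (\<lambda>j t. z * u j t)"
    using assms(2) by (auto simp: spec_L_def)
  have "PT_op \<sigma> u (inv \<sigma> j) x \<noteq> 0"
    using nz bij_is_surj[OF \<sigma>] by (simp add: PT_op_def surj_f_inv_f)
  moreover have "L_opr h (PT_op \<sigma> u) (\<lambda>j t. cnj z * PT_op \<sigma> u j t)"
    using PT[OF L] by (simp add: PT_op_def)
  ultimately show ?thesis
    using nz(1) unfolding spec_L_def by blast
qed

theorem theorem1:
  fixes h :: "'n::finite \<Rightarrow> complex"
  shows "(\<forall>z. z \<in> spec_L h \<longleftrightarrow> cnj z \<in> spec_L h) \<longleftrightarrow> PT_symmetric h"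
proof
  assume "\<forall>z. z \<in> spec_L h \<longleftrightarrow> cnj z \<in> spec_L h"
  then have "edge_poly (\<lambda>i. cnj (h i)) = edge_poly h"
    by (intro edge_poly_self_conjugate) blast
  then obtain \<sigma> where "bij \<sigma>" "\<And>i. h (\<sigma> i) = cnj (h i)"
    by (rule edge_poly_eq_imp_permutation) blast
  then show "PT_symmetric h" by (rule PT_symmetric_if_conjugating_permutation)
next
  assume "PT_symmetric h"
  then show "\<forall>z. z \<in> spec_L h \<longleftrightarrow> cnj z \<in> spec_L h"
    using PT_symmetric_imp_spec_L_reflected[of h] by (metis complex_cnj_cnj)
qed

end
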